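(* Let $u,v\in\mathcal{M}$ have the same number of $D$'s and the same number of $U$'s. Then $\phi(u)=\phi(v)$ if and only if the Ferrers boards $B_u$ and $B_v$ are rook-equivalent. (Consequently, rook-equivalence of $B_u,B_v$ is equivalent to each of: $u\overset{\mathrm{bal}}{\sim}v$; $u\overset{\mathrm{flip}}{\sim}v$; $u,v$ have the same final height and $H(u,z)=H(v,z)$; the same with $H_{NE}$; the same with $H_{SE}$; $\phi(u),\phi(v)$ act equally on $\Bbbk[x]$.)
   Context: $\Bbbk$ is a field of characteristic $0$; $\mathcal{M}$ is the free monoid on letters $D,U$; $\mathcal{W}=\Bbbk\langle D,U\mid DU-UD=1\rangle$ acting on $\Bbbk[x]$ by $D=d/dx$, $U=$ multiplication by $x$; $\phi:\mathcal{M}\to\mathcal{W}$ the monoid morphism $D\mapsto D,U\mapsto U$. For $w=w_1\cdots w_N$, $h_i=\#U-\#D$ in $w_1\cdots w_i$; final height $h_N$; $H(w,z)=\sum_{i=0}^Nz^{h_i}$, $H_{NE}(w,z)=\sum_{i<N,w_{i+1}=U}z^{h_i}$, $H_{SE}(w,z)=\sum_{i<N,w_{i+1}=D}z^{h_i}$. Balanced word: equally many $D$'s and $U$'s; $\omega$: anti-morphism of $\mathcal{M}$ swapping $U,D$; $\overset{\mathrm{bal}}{\sim}$: equivalence generated by $pyxq\leftrightarrow pxyq$ ($x,y$ balanced); $\overset{\mathrm{flip}}{\sim}$: equivalence generated by $p\omega(x)q\leftrightarrow pxq$ ($x$ balanced). A cell is a pair $(i,j)$ of positive integers, a board is a finite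 set of cells; a rook placement of $B$ is a subset of $B$ with no two cells sharing a first coordinate or a second coordinate; $r_k(B)$ is the number of $k$-element rook placements; boards $B,C$ are rook-equivalent if $r_k(B)=r_k(C)$ for all $k\ge0$. If $w$ contains $m$ letters $U$ and $d_j$ denotes the number of $D$'s preceding the $j$-th $U$ of $w$, then $B_w=\{(j,i):1\le j\le m,\ 1\le i\le d_j\}$. *)

theory Defs
  imports
    "HOL-Library.Poly_Mapping"
    "HOL-Computational_Algebra.Polynomial"
begin

section \<open>Words\<close>

datatype letter = D | U

type_synonym word = "letter list"

fun swap_letter :: "letter \<Rightarrow> letter" where
  "swap_letter D = U"
| "swap_letter U = D"

definition omega :: "word \<Rightarrow> word" where
  "omega w = rev (map swap_letter w)"

definition balanced :: "word \<Rightarrow> bool" where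
  "balanced w \<longleftrightarrow> count_list w D = count_list w U"

inductive bal_step :: "word \<Rightarrow> word \<Rightarrow> bool" where
  "balanced x \<Longrightarrow> balanced y \<Longrightarrow> bal_step (p @ y @ x @ q) (p @ x @ y @ q)"

definition bal_equiv :: "word \<Rightarrow> word \<Rightarrow> bool" where
  "bal_equiv = equivclp bal_step"

inductive flip_step :: "word \<Rightarrow> word \<Rightarrow> bool" where
  "balanced x \<Longrightarrow> flip_step (p @ omega x @ q) (p @ x @ q)"

definition flip_equiv :: "word \<Rightarrow> word \<Rightarrow> bool" where
  "flip_equiv = equivclp flip_step"

section \<open>Heights and their generating functions\<close>

definition height :: "word \<Rightarrow> nat \<Rightarrow> int" where
  "height w i = int (count_list (take i w) U) - int (count_list (take i w) D)"

definition final_height :: "word \<Rightarrow> int" where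
  "final_height w = height w (length w)"

text \<open>Heights may be negative, so the generating functions are Laurent polynomials over the
  integers: finitely supported functions from exponents to coefficients, with \<open>single h 1\<close>
  standing for the monomial \<open>z\<close> to the power \<open>h\<close>. As lists are indexed from \<open>0\<close>, the letter
  \<open>w ! i\<close> is the step that starts at height \<open>height w i\<close>.\<close>

type_synonym laurent_poly = "int \<Rightarrow>\<^sub>0 int"

definition H :: "word \<Rightarrow> laurent_poly" where
  "H w = (\<Sum>i\<le>length w. Poly_Mapping.single (height w i) 1)"

definition H_NE :: "word \<Rightarrow> laurent_poly" where
  "H_NE w = (\<Sum>i\<in>{i. i < length w \<and> w ! i = U}. Poly_Mapping.single (height w i) 1)"

definition H_SE :: "word \<Rightarrow> laurent_poly" where
  "H_SE w = (\<Sum>i\<in>{i. i < length w \<and> w ! i = D}. Poly_Mapping.single (height w i) 1)"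

section \<open>Boards and rook placements\<close>

type_synonym cell = "nat \<times> nat"

definition is_board :: "cell set \<Rightarrow> bool" where
  "is_board B \<longleftrightarrow> finite B \<and> B \<subseteq> {1..} \<times> {1..}"

definition rook_placement :: "cell set \<Rightarrow> cell set \<Rightarrow> bool" where
  "rook_placement B P \<longleftrightarrow> P \<subseteq> B \<and>
     (\<forall>c\<in>P. \<forall>c'\<in>P. c \<noteq> c' \<longrightarrow> fst c \<noteq> fst c' \<and> snd c \<noteq> snd c')"

definition rook_number :: "nat \<Rightarrow> cell set \<Rightarrow> nat" where
  "rook_number k B = card {P. rook_placement B P \<and> card P = k}"

definition rook_equivalent :: "cell set \<Rightarrow> cell set \<Rightarrow> bool" where
  "rook_equivalent B C \<longleftrightarrow> (\<forall>k. rook_number k B = rook_number k C)"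

text \<open>\<open>Ds_before w j\<close> is the number of \<open>D\<close>'s preceding the \<open>j\<close>-th \<open>U\<close> of \<open>w\<close>, where
  \<open>1 \<le> j \<le> count_list w U\<close>.\<close>

definition U_positions :: "word \<Rightarrow> nat list" where
  "U_positions w = filter (\<lambda>n. w ! n = U) [0..<length w]"

definition Ds_before :: "word \<Rightarrow> nat \<Rightarrow> nat" where
  "Ds_before w j = count_list (take (U_positions w ! (j - 1)) w) D"

definition ferrers_board :: "word \<Rightarrow> cell set" where
  "ferrers_board w =
     {(j, i). 1 \<le> j \<and> j \<le> count_list w U \<and> 1 \<le> i \<and> i \<le> Ds_before w j}"

lemma is_board_ferrers_board: "is_board (ferrers_board w)"
proof -
  have "ferrers_board w = (SIGMA j:{1..count_list w U}. {1..Ds_before w j})"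
    by (auto simp: ferrers_board_def)
  then show ?thesis by (auto simp: is_board_def)
qed

section \<open>The Weyl algebra\<close>

text \<open>With concatenation as the addition on lists, the monoid algebra
  \<open>letter list \<Rightarrow>\<^sub>0 'k\<close> is the free algebra on the letters \<open>D\<close> and \<open>U\<close>.\<close>

instantiation list :: (type) monoid_add
begin

definition zero_list_def: "0 = []"
definition plus_list_def: "xs + ys = xs @ ys"

instance by standard (simp_all add: zero_list_def plus_list_def)

end

type_synonym 'k free_algebra = "word \<Rightarrow>\<^sub>0 'k"

abbreviation word_monomial :: "word \<Rightarrow> 'k::field free_algebra" where
  "word_monomial w \<equiv> Poly_Mapping.single w 1"

definition weyl_relator :: "'k::field free_algebra" where
  "weyl_relator = word_monomial [D] * word_monomial [U] - word_monomial [U] * word_monomial [D] - 1"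

inductive_set weyl_ideal :: "('k::field free_algebra) set" where
  zero: "0 \<in> weyl_ideal"
| step: "f \<in> weyl_ideal \<Longrightarrow> f + a * weyl_relator * b \<in> weyl_ideal"

lemma weyl_ideal_add: "f \<in> weyl_ideal \<Longrightarrow> g \<in> weyl_ideal \<Longrightarrow> f + g \<in> weyl_ideal"
proof (induction f rule: weyl_ideal.induct)
  case zero
  then show ?case by simp
next
  case (step f a b)
  then show ?case
    using weyl_ideal.step[of "f + g" a b] by (simp add: add.assoc add.commute[of g])
qed

lemma weyl_ideal_lmult: "f \<in> weyl_ideal \<Longrightarrow> c * f \<in> weyl_ideal"
  by (induction f rule: weyl_ideal.induct)
     (auto simp: distrib_left simp flip: mult.assoc intro: weyl_ideal.intros)

lemma weyl_ideal_rmult: "f \<in> weyl_ideal \<Longrightarrow> f * c \<in> weyl_ideal"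
  by (induction f rule: weyl_ideal.induct)
     (auto simp: distrib_right mult.assoc[of _ _ c] intro: weyl_ideal.intros)

lemma weyl_ideal_uminus: "f \<in> weyl_ideal \<Longrightarrow> - f \<in> weyl_ideal"
  using weyl_ideal_lmult[of f "- 1"] by simp

lemma weyl_relator_in_weyl_ideal: "weyl_relator \<in> weyl_ideal"
  using weyl_ideal.step[OF weyl_ideal.zero, of 1 1] by simp

definition weyl_cong :: "'k::field free_algebra \<Rightarrow> 'k free_algebra \<Rightarrow> bool" where
  "weyl_cong f g \<longleftrightarrow> f - g \<in> weyl_ideal"

lemma equivp_weyl_cong: "equivp weyl_cong"
proof (rule equivpI)
  show "reflp weyl_cong"
    by (auto intro!: reflpI weyl_ideal.zero simp: weyl_cong_def)
  show "symp weyl_cong"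
    by (rule sympI) (use weyl_ideal_uminus in \<open>fastforce simp: weyl_cong_def\<close>)
  show "transp weyl_cong"
    by (rule transpI) (use weyl_ideal_add in \<open>fastforce simp: weyl_cong_def\<close>)
qed

quotient_type (overloaded) 'k weyl = "'k::field free_algebra" / weyl_cong
  by (rule equivp_weyl_cong)

instantiation weyl :: (field) ring
begin

lift_definition zero_weyl :: "'a weyl" is 0 .

lift_definition plus_weyl :: "'a weyl \<Rightarrow> 'a weyl \<Rightarrow> 'a weyl" is "(+)"
  unfolding weyl_cong_def add_diff_add by (rule weyl_ideal_add)

lift_definition uminus_weyl :: "'a weyl \<Rightarrow> 'a weyl" is uminus
  unfolding weyl_cong_def minus_diff_minus by (rule weyl_ideal_uminus)

lift_definition minus_weyl :: "'a weyl \<Rightarrow> 'a weyl \<Rightarrow> 'a weyl" is "(-)"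
proof -
  fix f f' g g' :: "'a free_algebra"
  assume "weyl_cong f f'" "weyl_cong g g'"
  then have "(f - f') + - (g - g') \<in> weyl_ideal"
    unfolding weyl_cong_def by (intro weyl_ideal_add weyl_ideal_uminus)
  then show "weyl_cong (f - g) (f' - g')"
    by (simp add: weyl_cong_def algebra_simps)
qed

lift_definition times_weyl :: "'a weyl \<Rightarrow> 'a weyl \<Rightarrow> 'a weyl" is "(*)"
proof -
  fix f f' g g' :: "'a free_algebra"
  assume "weyl_cong f f'" "weyl_cong g g'"
  then have "(f - f') * g + f' * (g - g') \<in> weyl_ideal"
    unfolding weyl_cong_def by (intro weyl_ideal_add weyl_ideal_lmult weyl_ideal_rmult)
  then show "weyl_cong (f * g) (f' * g')"
    by (simp add: weyl_cong_def algebra_simps)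
qed

instance
  by standard (transfer, simp add: weyl_cong_def weyl_ideal.zero algebra_simps)+

end

instantiation weyl :: (field) "{one, monoid_mult}"
begin

lift_definition one_weyl :: "'a weyl" is 1 .

instance
  by standard (transfer, simp add: weyl_cong_def weyl_ideal.zero)+

end

lift_definition weyl_letter :: "letter \<Rightarrow> 'k::field weyl" is "\<lambda>l. word_monomial [l]" .

lemma weyl_relation:
  "weyl_letter D * weyl_letter U - weyl_letter U * weyl_letter D = (1 :: 'k::field weyl)"
  by transfer (use weyl_relator_in_weyl_ideal in \<open>simp add: weyl_cong_def weyl_relator_def\<close>)

definition phi :: "word \<Rightarrow> 'k::field weyl" where
  "phi w = prod_list (map weyl_letter w)"

section \<open>The action on polynomials\<close>

fun letter_act :: "letter \<Rightarrow> 'k::field poly \<Rightarrow> 'k poly" where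
  "letter_act D p = pderiv p"
| "letter_act U p = [:0, 1:] * p"

definition word_act :: "word \<Rightarrow> 'k::field poly \<Rightarrow> 'k poly" where
  "word_act w = foldr letter_act w"

definition free_act :: "'k::field free_algebra \<Rightarrow> 'k poly \<Rightarrow> 'k poly" where
  "free_act f p =
     (\<Sum>w\<in>Poly_Mapping.keys f. smult (Poly_Mapping.lookup f w) (word_act w p))"

lemma letter_act_add: "letter_act l (p + q) = letter_act l p + letter_act l q"
  by (cases l) (simp_all add: pderiv_add algebra_simps)

lemma letter_act_smult: "letter_act l (smult c p) = smult c (letter_act l p)"
  by (cases l) (simp_all add: pderiv_smult)

lemma word_act_append: "word_act (v @ w) p = word_act v (word_act w p)"
  by (simp add: word_act_def)

lemma word_act_add: "word_act w (p + q) = word_act w p + word_act w q"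
  by (induction w) (simp_all add: word_act_def letter_act_add)

lemma word_act_smult: "word_act w (smult c p) = smult c (word_act w p)"
  by (induction w) (simp_all add: word_act_def letter_act_smult)

lemma free_act_superset:
  assumes "finite S" "Poly_Mapping.keys f \<subseteq> S"
  shows "free_act f p = (\<Sum>w\<in>S. smult (Poly_Mapping.lookup f w) (word_act w p))"
  unfolding free_act_def using assms
  by (intro sum.mono_neutral_left) (auto simp: in_keys_iff)

lemma free_act_zero [simp]: "free_act 0 p = 0"
  by (simp add: free_act_def)

lemma free_act_single: "free_act (Poly_Mapping.single w c) p = smult c (word_act w p)"
  by (subst free_act_superset[of "{w}"]) auto

lemma free_act_add: "free_act (f + g) p = free_act f p + free_act g p"
proof -
  let ?S = "Poly_Mapping.keys f \<union> Poly_Mapping.keys g"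
  have "Poly_Mapping.keys (f + g) \<subseteq> ?S" by (rule keys_add)
  then show ?thesis
    by (simp add: free_act_superset[of ?S] lookup_add smult_add_left sum.distrib)
qed

lemma free_act_uminus: "free_act (- f) p = - free_act f p"
  using free_act_add[of f "- f" p] by (simp add: eq_neg_iff_add_eq_0 add.commute)

lemma free_act_diff: "free_act (f - g) p = free_act f p - free_act g p"
  using free_act_add[of f "- g" p] by (simp add: free_act_uminus)

lemma free_act_add_right: "free_act f (p + q) = free_act f p + free_act f q"
  by (simp add: free_act_def word_act_add smult_add_right sum.distrib)

lemma free_act_zero_right [simp]: "free_act f 0 = 0"
proof -
  have "free_act f 0 + free_act f 0 = free_act f 0 + 0"
    using free_act_add_right[of f 0 0] by simp
  then show ?thesis by (simp only: add_left_cancel)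
qed

lemma free_algebra_induct [case_names zero single add]:
  fixes f :: "'k::field free_algebra"
  assumes "P 0" "\<And>w c. P (Poly_Mapping.single w c)" "\<And>f g. P f \<Longrightarrow> P g \<Longrightarrow> P (f + g)"
  shows "P f"
proof (induction f rule: update_induct)
  case const
  then show ?case by (rule assms(1))
next
  case (update f w c)
  have "Poly_Mapping.update w c f = f + Poly_Mapping.single w c"
    using update by (intro poly_mapping_eqI) (auto simp: lookup_update lookup_add lookup_single in_keys_iff)
  then show ?case using assms update by simp
qed

lemma free_act_mult: "free_act (f * g) p = free_act f (free_act g p)"
proof (induction f rule: free_algebra_induct)
  case zero
  then show ?case by simp
next
  case (single v c)
  show ?case
  proof (induction g rule: free_algebra_induct)
    case zero
    then show ?case by simp
  next
    case (single w d)
    then show ?case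
      by (simp add: mult_single free_act_single plus_list_def word_act_append word_act_smult)
  next
    case (add f g)
    then show ?case by (simp add: distrib_left free_act_add free_act_add_right)
  qed
next
  case (add f g)
  then show ?case by (simp add: distrib_right free_act_add)
qed

lemma free_act_one: "free_act 1 p = p"
  by (simp add: free_act_single zero_list_def word_act_def flip: single_one)

lemma free_act_weyl_relator: "free_act weyl_relator p = 0"
  by (simp add: weyl_relator_def free_act_diff free_act_mult free_act_single free_act_one
      word_act_def pderiv_mult pderiv_pCons)

lemma free_act_weyl_ideal: "f \<in> weyl_ideal \<Longrightarrow> free_act f p = 0"
  by (induction f rule: weyl_ideal.induct)
     (simp_all add: free_act_add free_act_mult free_act_weyl_relator)

lift_definition weyl_act :: "'k::field weyl \<Rightarrow> 'k poly \<Rightarrow> 'k poly" is free_act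
  by (rule ext) (metis weyl_cong_def free_act_diff free_act_weyl_ideal eq_iff_diff_eq_0)

lemma weyl_act_letter: "weyl_act (weyl_letter l) = letter_act l"
  by (rule ext, transfer) (simp add: free_act_single word_act_def)

lemma weyl_act_one: "weyl_act 1 p = p"
  by transfer (rule free_act_one)

lemma weyl_act_mult: "weyl_act (a * b) p = weyl_act a (weyl_act b p)"
  by transfer (rule free_act_mult)

lemma weyl_act_add: "weyl_act (a + b) p = weyl_act a p + weyl_act b p"
  by transfer (rule free_act_add)

end

theory Submission
  imports Defs
begin

text \<open>Normal ordering gives \<open>\<phi>(w) = \<Sum>\<^sub>k r\<^sub>k(B\<^sub>w) U\<^sup>a\<^sup>-\<^sup>k D\<^sup>b\<^sup>-\<^sup>k\<close>, where \<open>a\<close> and \<open>b\<close> count the letters \<open>U\<close> and \<open>D\<close>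
  of \<open>w\<close>, so the rook numbers determine \<open>\<phi>(w)\<close>; conversely they can be read off from its action on
  monomials. The word \<open>w\<close> maps \<open>x\<^sup>n\<close> to \<open>\<Prod>\<^sub>i (n + h\<^sub>N - h\<^sub>i + 1)\<close> times a power of \<open>x\<close>, the product
  ranging over the \<open>D\<close>-steps; comparing the zeros of this polynomial in \<open>n\<close> recovers \<open>H\<^sub>S\<^sub>E\<close>. The three
  generating functions determine each other because every height is crossed alternately upwards
  and downwards. Words with the same \<open>H\<close> are related by commutations of balanced factors: such
  commutations make the first letters agree, and one proceeds by induction on the length. Finally,
  a commutation is a composition of flips, flips preserve \<open>H\<close>, and balanced words act diagonally on
  the monomials, so that they commute as operators.\<close>

lemma equivclp_invariant:
  assumes "equivclp r x y" and "\<And>a b. r a b \<Longrightarrow> f a = f b"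
  shows "f x = f y"
  using assms(1) by (induction rule: equivclp_induct) (use assms(2) in force)+

section \<open>Heights\<close>

fun letter_step :: "letter \<Rightarrow> int" where
  "letter_step D = -1"
| "letter_step U = 1"

lemma letter_step_swap [simp]: "letter_step (swap_letter l) = - letter_step l"
  by (cases l) auto

lemma balanced_iff: "balanced w \<longleftrightarrow> final_height w = 0"
  by (auto simp: balanced_def final_height_def height_def)

lemma final_height_Nil [simp]: "final_height [] = 0"
  by (simp add: final_height_def height_def)

lemma height_Cons_Suc: "height (l # w) (Suc i) = letter_step l + height w i"
  by (cases l) (auto simp: height_def)

lemma height_0 [simp]: "height w 0 = 0"
  by (simp add: height_def)

lemma final_height_Cons [simp]: "final_height (l # w) = letter_step l + final_height w"
  by (simp add: final_height_def height_Cons_Suc)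

lemma final_height_append [simp]: "final_height (v @ w) = final_height v + final_height w"
  by (induction v) auto

lemma final_height_omega [simp]: "final_height (omega w) = - final_height w"
  by (induction w) (auto simp: omega_def)

text \<open>Reading coefficients as functions on all integers turns prepending a letter into a shift
  of the argument.\<close>

definition visits :: "word \<Rightarrow> int \<Rightarrow> int" where
  "visits w h = Poly_Mapping.lookup (H w) h"

definition U_steps :: "word \<Rightarrow> int \<Rightarrow> int" where
  "U_steps w h = Poly_Mapping.lookup (H_NE w) h"

definition D_steps :: "word \<Rightarrow> int \<Rightarrow> int" where
  "D_steps w h = Poly_Mapping.lookup (H_SE w) h"

lemma H_eq_iff: "H u = H v \<longleftrightarrow> visits u = visits v"
  by (auto simp: visits_def fun_eq_iff intro: poly_mapping_eqI)

lemma H_NE_eq_iff: "H_NE u = H_NE v \<longleftrightarrow> U_steps u = U_steps v"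
  by (auto simp: U_steps_def fun_eq_iff intro: poly_mapping_eqI)

lemma H_SE_eq_iff: "H_SE u = H_SE v \<longleftrightarrow> D_steps u = D_steps v"
  by (auto simp: D_steps_def fun_eq_iff intro: poly_mapping_eqI)

lemma visits_altdef: "visits w h = (\<Sum>i\<le>length w. of_bool (height w i = h))"
  unfolding visits_def H_def lookup_sum by (intro sum.cong) (auto simp: lookup_single)

lemma sum_letter_positions:
  "(\<Sum>i\<in>{i. i < length w \<and> w ! i = l}. f i) = (\<Sum>i<length w. if w ! i = l then f i else 0)"
  by (subst sum.inter_filter [symmetric]) (auto intro: sum.cong)

lemma U_steps_altdef: "U_steps w h = (\<Sum>i<length w. of_bool (w ! i = U \<and> height w i = h))"
  unfolding U_steps_def H_NE_def sum_letter_positions lookup_sum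
  by (intro sum.cong) (auto simp: lookup_single)

lemma D_steps_altdef: "D_steps w h = (\<Sum>i<length w. of_bool (w ! i = D \<and> height w i = h))"
  unfolding D_steps_def H_SE_def sum_letter_positions lookup_sum
  by (intro sum.cong) (auto simp: lookup_single)

lemma visits_Nil [simp]: "visits [] h = of_bool (h = 0)"
  by (auto simp: visits_altdef)

lemma visits_Cons [simp]: "visits (l # w) h = of_bool (h = 0) + visits w (h - letter_step l)"
  unfolding visits_altdef length_Cons sum.atMost_Suc_shift
  by (auto simp: height_Cons_Suc eq_diff_eq add.commute)

lemma U_steps_Nil [simp]: "U_steps [] h = 0"
  by (simp add: U_steps_altdef)

lemma U_steps_Cons [simp]:
  "U_steps (l # w) h = of_bool (l = U \<and> h = 0) + U_steps w (h - letter_step l)"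
  unfolding U_steps_altdef length_Cons sum.lessThan_Suc_shift
  by (auto simp: height_Cons_Suc eq_diff_eq add.commute)

lemma D_steps_Nil [simp]: "D_steps [] h = 0"
  by (simp add: D_steps_altdef)

lemma D_steps_Cons [simp]:
  "D_steps (l # w) h = of_bool (l = D \<and> h = 0) + D_steps w (h - letter_step l)"
  unfolding D_steps_altdef length_Cons sum.lessThan_Suc_shift
  by (auto simp: height_Cons_Suc eq_diff_eq add.commute)

text \<open>The junction is both the last vertex of \<open>v\<close> and the first of
  \<open>w\<close>, so one copy is removed.\<close>

lemma visits_append:
  "visits (v @ w) h = visits v h + visits w (h - final_height v) - of_bool (h = final_height v)"
proof (induction v arbitrary: h)
  case (Cons l v)
  show ?case using Cons.IH[of "h - letter_step l"] by (auto simp: algebra_simps of_bool_def)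
qed simp

text \<open>\<open>omega\<close> traces the same path backwards from the old endpoint, whence the
  shift; it disappears for balanced words.\<close>

lemma visits_omega: "visits (omega w) h = visits w (h + final_height w)"
proof (induction w arbitrary: h)
  case (Cons l w)
  have "omega (l # w) = omega w @ [swap_letter l]" by (simp add: omega_def)
  then show ?case by (auto simp: visits_append Cons.IH algebra_simps)
qed (simp add: omega_def)

text \<open>Every vertex except the last starts exactly one step.\<close>

lemma visits_eq_steps: "visits w h = U_steps w h + D_steps w h + of_bool (h = final_height w)"
proof (induction w arbitrary: h)
  case (Cons l w)
  show ?case using Cons.IH[of "h - letter_step l"] by (cases l) auto
qed simp

text \<open>Up- and down-crossings of the edge between \<open>h\<close> and \<open>h + 1\<close> alternate.\<close>

lemma U_steps_minus_D_steps:
  "U_steps w h - D_steps w (h + 1) =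
     of_bool (0 \<le> h \<and> h < final_height w) - of_bool (final_height w \<le> h \<and> h < 0)"
proof (induction w arbitrary: h)
  case (Cons l w)
  show ?case
  proof (cases l)
    case D
    have "U_steps (l # w) h = U_steps w (h + 1)"
      and "D_steps (l # w) (h + 1) = of_bool (h = - 1) + D_steps w (h + 1 + 1)"
      and "final_height (l # w) = final_height w - 1"
      by (auto simp: D)
    with Cons.IH[of "h + 1"] show ?thesis
      unfolding of_bool_def by (smt (verit))
  next
    case U
    have "U_steps (l # w) h = of_bool (h = 0) + U_steps w (h - 1)"
      and "D_steps (l # w) (h + 1) = D_steps w (h - 1 + 1)"
      and "final_height (l # w) = final_height w + 1"
      by (auto simp: U)
    with Cons.IH[of "h - 1"] show ?thesis
      unfolding of_bool_def by (smt (verit))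
  qed
qed simp

lemma U_steps_eq_iff_D_steps_eq:
  assumes "final_height u = final_height v"
  shows "U_steps u = U_steps v \<longleftrightarrow> D_steps u = D_steps v"
proof -
  have diff: "U_steps u h - D_steps u (h + 1) = U_steps v h - D_steps v (h + 1)" for h
    using assms by (simp add: U_steps_minus_D_steps)
  show ?thesis
  proof
    assume "U_steps u = U_steps v"
    then show "D_steps u = D_steps v" using diff[of "h - 1" for h] by (auto simp: fun_eq_iff)
  next
    assume "D_steps u = D_steps v"
    then show "U_steps u = U_steps v" using diff by (auto simp: fun_eq_iff)
  qed
qed

text \<open>For equal visits, the difference of the two \<open>U_steps\<close> functions changes
  sign from each height to the next. Finite support provides one zero, which then spreads to all
  heights.\<close>

lemma visits_eq_iff_U_steps_eq:
  assumes "final_height u = final_height v"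
  shows "visits u = visits v \<longleftrightarrow> U_steps u = U_steps v"
proof
  assume "U_steps u = U_steps v"
  then show "visits u = visits v"
    using U_steps_eq_iff_D_steps_eq[OF assms] assms by (auto simp: fun_eq_iff visits_eq_steps)
next
  assume eq: "visits u = visits v"
  define d where "d h = U_steps u h - U_steps v h" for h
  have "U_steps u (h - 1) - D_steps u h = U_steps v (h - 1) - D_steps v h" for h
    using assms U_steps_minus_D_steps[of _ "h - 1"] by simp
  moreover have "U_steps u h + D_steps u h = U_steps v h + D_steps v h" for h
    using fun_cong[OF eq, of h] assms by (simp add: visits_eq_steps)
  ultimately have alternating: "d h = - d (h - 1)" for h
    unfolding d_def by (smt (verit))
  have "finite (Poly_Mapping.keys (H_NE u) \<union> Poly_Mapping.keys (H_NE v))"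
    by simp
  then obtain h\<^sub>0 where "h\<^sub>0 \<notin> Poly_Mapping.keys (H_NE u) \<union> Poly_Mapping.keys (H_NE v)"
    using ex_new_if_finite infinite_UNIV_int by blast
  then have zero: "d h\<^sub>0 = 0"
    by (simp add: d_def U_steps_def in_keys_iff)
  have "d h = 0" for h
  proof (induction h rule: int_induct[where k = h\<^sub>0])
    case base
    show ?case by (rule zero)
  next
    case (step1 h)
    then show ?case using alternating[of "h + 1"] by simp
  next
    case (step2 h)
    then show ?case using alternating[of h] by simp
  qed
  then show "U_steps u = U_steps v" by (simp add: d_def fun_eq_iff)
qed

section \<open>Commutations and flips of balanced factors\<close>

lemma bal_equiv_refl [simp]: "bal_equiv w w"
  by (simp add: bal_equiv_def equivclp_def)

lemma bal_equiv_sym: "bal_equiv v w \<Longrightarrow> bal_equiv w v"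
  unfolding bal_equiv_def by (rule equivclp_sym)

lemma bal_equiv_trans [trans]: "bal_equiv u v \<Longrightarrow> bal_equiv v w \<Longrightarrow> bal_equiv u w"
  unfolding bal_equiv_def by (rule transpD[OF transp_equivclp])

lemma bal_step_Cons: "bal_step v w \<Longrightarrow> bal_step (l # v) (l # w)"
  by (metis append_Cons bal_step.simps)

lemma bal_step_imp_equiv: "bal_step v w \<Longrightarrow> bal_equiv v w"
  unfolding bal_equiv_def by (rule r_into_equivclp)

lemma bal_equiv_Cons:
  assumes "bal_equiv v w"
  shows "bal_equiv (l # v) (l # w)"
  using assms[unfolded bal_equiv_def]
proof (induction rule: equivclp_induct)
  case (step y z)
  then have "bal_equiv (l # y) (l # z)"
    by (metis bal_step_Cons bal_step_imp_equiv bal_equiv_sym)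
  then show ?case using step.IH by (metis bal_equiv_trans)
qed simp

lemma flip_equiv_refl [simp]: "flip_equiv w w"
  by (simp add: flip_equiv_def equivclp_def)

lemma flip_equiv_sym: "flip_equiv v w \<Longrightarrow> flip_equiv w v"
  unfolding flip_equiv_def by (rule equivclp_sym)

lemma flip_equiv_trans [trans]: "flip_equiv u v \<Longrightarrow> flip_equiv v w \<Longrightarrow> flip_equiv u w"
  unfolding flip_equiv_def by (rule transpD[OF transp_equivclp])

lemma flip_step_imp_equiv: "flip_step v w \<Longrightarrow> flip_equiv v w"
  unfolding flip_equiv_def by (rule r_into_equivclp)

lemma omega_append: "omega (v @ w) = omega w @ omega v"
  by (simp add: omega_def)

text \<open>Flipping \<open>y\<close> and \<open>x\<close> separately turns \<open>y @ x\<close>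
  into \<open>omega y @ omega x\<close>, which is \<open>omega (x @ y)\<close>; one flip of the
  whole product finishes.\<close>

lemma bal_step_imp_flip_equiv:
  assumes "bal_step v w"
  shows "flip_equiv v w"
  using assms
proof cases
  case (1 x y p q)
  have "flip_equiv (p @ omega y @ omega x @ q) (p @ y @ omega x @ q)"
    using flip_step.intros[of y p "omega x @ q"] 1 by (intro flip_step_imp_equiv) simp
  also have "flip_equiv (p @ y @ omega x @ q) (p @ y @ x @ q)"
    using flip_step.intros[of x "p @ y" q] 1 by (intro flip_step_imp_equiv) simp
  finally have "flip_equiv v (p @ omega y @ omega x @ q)"
    using 1 by (simp add: flip_equiv_sym)
  also have "flip_equiv (p @ omega y @ omega x @ q) w"
    using flip_step.intros[of "x @ y" p q] 1
    by (intro flip_step_imp_equiv) (simp add: omega_append balanced_iff)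
  finally show ?thesis .
qed

lemma bal_equiv_imp_flip_equiv:
  assumes "bal_equiv v w"
  shows "flip_equiv v w"
  using assms unfolding bal_equiv_def
proof (induction rule: equivclp_induct)
  case (step y z)
  then have "flip_equiv y z"
    by (metis bal_step_imp_flip_equiv flip_equiv_sym)
  with step.IH show ?case by (rule flip_equiv_trans)
qed simp

lemma flip_equiv_imp_visits_eq:
  assumes "flip_equiv v w"
  shows "visits v = visits w"
proof (rule equivclp_invariant[of flip_step _ _ visits])
  show "equivclp flip_step v w" using assms by (simp add: flip_equiv_def)
  show "visits v = visits w" if "flip_step v w" for v w
    using that by cases (auto simp: fun_eq_iff visits_append visits_omega balanced_iff)
qed

lemma bal_equiv_imp_length_eq:
  assumes "bal_equiv v w"
  shows "length v = length w"
proof (rule equivclp_invariant[of bal_step _ _ length])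
  show "equivclp bal_step v w" using assms by (simp add: bal_equiv_def)
  show "length a = length b" if "bal_step a b" for a b
    using that by cases auto
qed

lemma bal_equiv_imp_final_height_eq:
  assumes "bal_equiv v w"
  shows "final_height v = final_height w"
proof (rule equivclp_invariant[of bal_step _ _ final_height])
  show "equivclp bal_step v w" using assms by (simp add: bal_equiv_def)
  show "final_height a = final_height b" if "bal_step a b" for a b
    using that by cases auto
qed

section \<open>Rearranging words with equal visit counts\<close>

lemma visits_nonneg: "visits w h \<ge> 0"
  by (auto simp: visits_altdef intro: sum_nonneg)

lemma visits_0_pos: "visits w 0 > 0"
  by (cases w) (simp_all add: add_pos_nonneg visits_nonneg)

lemma visits_nonzeroD:
  assumes "visits w h \<noteq> 0"
  obtains p q where "w = p @ q" "final_height p = h"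
proof -
  have "\<exists>i\<le>length w. height w i = h"
  proof (rule ccontr)
    assume "\<not> ?thesis"
    then have "visits w h = 0" unfolding visits_altdef by (intro sum.neutral) auto
    with assms show False by contradiction
  qed
  then obtain i where "i \<le> length w" "height w i = h" by blast
  then show thesis
    using that[of "take i w" "drop i w"] by (simp add: final_height_def height_def)
qed

text \<open>Shorten the prefix while its height keeps the sign of \<open>l\<close>. The letter whose
  removal destroys that sign is an \<open>l\<close> taken from height 0.\<close>

lemma first_passage:
  assumes "letter_step l * final_height p > 0"
  obtains x y where "p = x @ l # y" "balanced x"
proof -
  have "\<exists>x y. p = x @ l # y \<and> balanced x"
    using assms
  proof (induction p rule: rev_induct)
    case (snoc a p)
    show ?case
    proof (cases "letter_step l * final_height p > 0")
      case True
      then obtain x y where "p = x @ l # y" "balanced x" using snoc.IH by blast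
      then show ?thesis by (intro exI[of _ x] exI[of _ "y @ [a]"]) simp
    next
      case False
      then have "a = l" "final_height p = 0"
        using snoc.prems by (cases l; cases a; simp)+
      then show ?thesis by (intro exI[of _ p] exI[of _ "[]"]) (simp add: balanced_iff)
    qed
  qed simp
  then show thesis using that by blast
qed

text \<open>Write \<open>w = x @ l # z\<close> with \<open>x\<close> balanced. As \<open>w\<close>
  does not end on the side of \<open>l\<close>, the rest \<open>z\<close> must step back, which
  closes a balanced factor beginning with this \<open>l\<close>; that factor commutes with
  \<open>x\<close>.\<close>

lemma bal_equiv_to_front:
  assumes "visits w (letter_step l) \<noteq> 0" and "letter_step l * final_height w \<le> 0"
  obtains w' where "bal_equiv w (l # w')"
proof -
  obtain p q where w: "w = p @ q" and p: "final_height p = letter_step l"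
    using assms(1) by (rule visits_nonzeroD)
  have "letter_step l * final_height p > 0" unfolding p by (cases l) auto
  then obtain x y where "p = x @ l # y" and x: "balanced x" by (rule first_passage)
  then obtain z where w: "w = x @ l # z" using w by simp
  have "letter_step (swap_letter l) * final_height z > 0"
    using assms(2) x by (cases l) (auto simp: w balanced_iff)
  then obtain a b where z: "z = a @ swap_letter l # b" and a: "balanced a" by (rule first_passage)
  have "balanced (l # a @ [swap_letter l])" using a by (simp add: balanced_iff)
  from bal_step.intros[OF this x, of "[]" b]
  have "bal_step w (l # a @ [swap_letter l] @ x @ b)" by (simp add: w z)
  then show thesis using that by (auto intro: bal_step_imp_equiv)
qed

text \<open>If the first letters differ, both words visit the heights \<open>1\<close> and \<open>- 1\<close>, and the sign of the
  final height decides which of the two words returns often enough to have a balanced factor moved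
  to its front.\<close>

lemma visits_eq_imp_bal_equiv:
  assumes "length u = length v" "final_height u = final_height v" "visits u = visits v"
  shows "bal_equiv u v"
  using assms
proof (induction "length u" arbitrary: u v)
  case 0
  then show ?case by simp
next
  case (Suc n)
  have same_letter: "bal_equiv (l # u') (l # v')"
    if "length (l # u') = Suc n" "length (l # v') = Suc n"
      and fh: "final_height (l # u') = final_height (l # v')"
      and vis: "visits (l # u') = visits (l # v')" for l u' v'
  proof (intro bal_equiv_Cons Suc.hyps(1))
    show "n = length u'" "length u' = length v'" using that(1,2) by simp_all
    show "final_height u' = final_height v'" using fh by simp
    show "visits u' = visits v'"
    proof
      fix h show "visits u' h = visits v' h"
        using fun_cong[OF vis, of "h + letter_step l"] by simp
    qed
  qed
  have front: "bal_equiv (l # u') w"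
    if len: "length (l # u') = Suc n" "length w = Suc n"
      and fh: "final_height (l # u') = final_height w"
      and vis: "visits (l # u') = visits w"
      and sign: "letter_step l * final_height w \<le> 0" for l u' w
  proof -
    have "visits (l # u') (letter_step l) > 0"
      using visits_0_pos[of u'] by (simp add: add_nonneg_pos)
    then have "visits w (letter_step l) \<noteq> 0" by (simp only: vis)
    then obtain w' where w': "bal_equiv w (l # w')" using sign by (rule bal_equiv_to_front)
    \<comment> \<open>Commutations preserve length, final height and visits, so
      \<open>l # w'\<close> can replace \<open>w\<close> and the case of a common first letter
      applies.\<close>
    have "bal_equiv (l # u') (l # w')"
    proof (rule same_letter)
      show "length (l # u') = Suc n" by (rule len)
      show "length (l # w') = Suc n"
        using bal_equiv_imp_length_eq[OF w'] len(2) by (rule subst)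
      show "final_height (l # u') = final_height (l # w')"
        using fh bal_equiv_imp_final_height_eq[OF w'] by (rule trans)
      show "visits (l # u') = visits (l # w')"
        using vis flip_equiv_imp_visits_eq[OF bal_equiv_imp_flip_equiv[OF w']] by (rule trans)
    qed
    also have "bal_equiv (l # w') w" using w' by (rule bal_equiv_sym)
    finally show ?thesis .
  qed
  have len: "length u = Suc n" "length v = Suc n" using Suc.hyps(2) Suc.prems(1) by simp_all
  obtain l u' where u: "u = l # u'" using len(1) by (cases u) auto
  obtain m v' where v: "v = m # v'" using len(2) by (cases v) auto
  \<comment> \<open>Different first letters step in opposite directions, so one of the two sign
    conditions holds.\<close>
  consider "letter_step l * final_height v \<le> 0" | "l = m" | "letter_step m * final_height u \<le> 0"
    unfolding Suc.prems(2) by (cases l; cases m; force)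
  then show ?case
  proof cases
    case 1
    then show ?thesis using front len Suc.prems unfolding u by blast
  next
    case 2
    then show ?thesis using same_letter len Suc.prems unfolding u v by blast
  next
    case 3
    then have "bal_equiv v u" using front len Suc.prems(2,3)[symmetric] unfolding v by blast
    then show ?thesis by (rule bal_equiv_sym)
  qed
qed

section \<open>The action on monomials\<close>

lemma word_act_Nil [simp]: "word_act [] p = p"
  by (simp add: word_act_def)

lemma word_act_Cons [simp]: "word_act (l # w) p = letter_act l (word_act w p)"
  by (simp add: word_act_def)

lemma U_mult_monom: "[:0, 1:] * monom (c :: 'k::field) n = monom c (Suc n)"
  by (simp add: monom_Suc)

text \<open>The word \<open>w\<close> maps \<open>x\<^sup>n\<close> to the value of this polynomial at \<open>n\<close> times a power of \<open>x\<close>: every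
  letter \<open>D\<close> contributes the exponent it meets.\<close>

fun act_poly :: "word \<Rightarrow> 'k::field poly" where
  "act_poly [] = 1"
| "act_poly (D # w) = [:of_int (final_height w), 1:] * act_poly w"
| "act_poly (U # w) = act_poly w"

lemma act_poly_nonzero [simp]: "act_poly w \<noteq> 0"
  by (induction w rule: act_poly.induct) (auto simp del: mult_pCons_left)

text \<open>A negative exponent can only arise if some \<open>D\<close> met exponent 0, giving a
  zero factor. This makes the truncation by \<open>nat\<close> in \<open>word_act_monom\<close>
  harmless.\<close>

lemma poly_act_poly_negative:
  "int n + final_height w < 0 \<Longrightarrow> poly (act_poly w :: 'k::field poly) (of_nat n) = 0"
proof (induction w rule: act_poly.induct)
  case (2 w)
  show ?case
  proof (cases "int n + final_height w = 0")
    case True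
    then have "of_int (int n + final_height w) = (0 :: 'k)" by (simp only: of_int_0)
    then show ?thesis by (simp add: add.commute del: mult_pCons_left)
  next
    case False
    then show ?thesis using 2 by (simp del: mult_pCons_left)
  qed
qed auto

lemma word_act_monom:
  "word_act w (monom (1 :: 'k::field) n) =
     monom (poly (act_poly w) (of_nat n)) (nat (int n + final_height w))"
proof (induction w rule: act_poly.induct)
  case 1
  then show ?case by simp
next
  case (2 w)
  show ?case
  proof (cases "int n + final_height w < 0")
    case True
    then show ?thesis using 2 by (simp add: poly_act_poly_negative del: mult_pCons_left)
  next
    case False
    then obtain m where m: "int n + final_height w = int m" by (metis nonneg_int_cases not_less)
    then have "of_int (final_height w) + of_nat n = (of_nat m :: 'k)"
      by (metis add.commute of_int_add of_int_of_nat_eq)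
    \<comment> \<open>For \<open>m = 0\<close> the truncated exponent does no harm, since the
      derivative has the factor \<open>m\<close>.\<close>
    moreover have "nat (int n + (- 1 + final_height w)) = m - 1" using m by simp
    ultimately show ?thesis using 2 m by (simp add: pderiv_monom del: mult_pCons_left)
  qed
next
  case (3 w)
  show ?case
  proof (cases "int n + final_height w < 0")
    case True
    then show ?thesis using 3 by (simp add: poly_act_poly_negative del: mult_pCons_left)
  next
    case False
    then have "nat (int n + (1 + final_height w)) = Suc (nat (int n + final_height w))" by simp
    then show ?thesis using 3 by (simp add: U_mult_monom del: mult_pCons_left)
  qed
qed

text \<open>A \<open>D\<close> followed by a suffix of final height \<open>a\<close> contributes a
  factor with root \<open>- a\<close>, and measured from the left it starts at height
  \<open>final_height w + 1 - a\<close>. In characteristic 0 distinct \<open>a\<close> give distinct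
  roots.\<close>

lemma order_act_poly:
  "int (Polynomial.order (- of_int a) (act_poly w :: 'k::field_char_0 poly)) =
     D_steps w (final_height w + 1 - a)"
proof (induction w rule: act_poly.induct)
  case (2 w)
  let ?q = "[:of_int (final_height w), 1:] :: 'k poly"
  have "Polynomial.order (- of_int a) ?q = of_bool (a = final_height w)"
  proof (cases "a = final_height w")
    case True
    then show ?thesis using order_power_n_n[of "- of_int a :: 'k" 1] by simp
  next
    case False
    then show ?thesis by (auto intro!: order_0I)
  qed
  then show ?case
    using 2 by (simp add: order_mult add.commute diff_add_eq add_diff_eq del: mult_pCons_left)
qed (auto simp: algebra_simps)

text \<open>The two \<open>act_poly\<close> agree at all natural numbers, which are infinitely many
  in characteristic 0. Hence they coincide, and so do their root multiplicities.\<close>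

lemma act_eq_imp_D_steps_eq:
  fixes u v :: word
  assumes "final_height u = final_height v"
    and "\<And>p :: 'k::field_char_0 poly. word_act u p = word_act v p"
  shows "D_steps u = D_steps v"
proof -
  have "poly (act_poly u :: 'k poly) (of_nat n) = poly (act_poly v) (of_nat n)" for n
    using assms(2)[of "monom 1 n"] assms(1) by (simp add: word_act_monom)
  then have "range of_nat \<subseteq> {x. poly (act_poly u - act_poly v :: 'k poly) x = 0}" by auto
  moreover have "infinite (range (of_nat :: nat \<Rightarrow> 'k))"
    by (simp add: finite_image_iff inj_of_nat)
  ultimately have eq: "act_poly u = (act_poly v :: 'k poly)"
    using poly_roots_finite finite_subset by (metis right_minus_eq)
  show ?thesis
  proof
    fix h
    show "D_steps u h = D_steps v h"
      using order_act_poly[where 'k = 'k, of "final_height u + 1 - h" u]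
        order_act_poly[where 'k = 'k, of "final_height v + 1 - h" v] eq assms(1) by simp
  qed
qed

lemma word_act_0 [simp]: "word_act w 0 = 0"
  using word_act_smult[of w 0 0] by simp

lemma word_act_eqI:
  assumes "\<And>n. word_act u (monom 1 n) = word_act v (monom (1 :: 'k::field) n)"
  shows "word_act u (p :: 'k poly) = word_act v p"
proof -
  have sum: "word_act w (\<Sum>i\<in>A. f i) = (\<Sum>i\<in>A. word_act w (f i))" for w A and f :: "nat \<Rightarrow> 'k poly"
    by (induction A rule: infinite_finite_induct) (simp_all add: word_act_add)
  have p: "p = (\<Sum>i\<le>degree p. smult (coeff p i) (monom 1 i))"
    by (simp add: smult_monom poly_as_sum_of_monoms)
  have "word_act u (\<Sum>i\<le>degree p. smult (coeff p i) (monom 1 i)) =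
    word_act v (\<Sum>i\<le>degree p. smult (coeff p i) (monom 1 i))"
    by (simp only: sum word_act_smult assms)
  with p show ?thesis by metis
qed

lemma bal_equiv_imp_act_eq:
  assumes "bal_equiv u v"
  shows "word_act u = (word_act v :: 'k::field poly \<Rightarrow> 'k poly)"
proof (rule equivclp_invariant[of bal_step])
  show "equivclp bal_step u v" using assms by (simp add: bal_equiv_def)
  fix a b assume "bal_step a b"
  then show "word_act a = (word_act b :: 'k poly \<Rightarrow> 'k poly)"
  proof cases
    case (1 x y p q)
    have diag: "word_act w (monom 1 n) = smult (poly (act_poly w) (of_nat n)) (monom (1 :: 'k) n)"
      if "balanced w" for w n
      using that by (simp add: word_act_monom balanced_iff smult_monom)
    have "word_act (y @ x) f = word_act (x @ y) f" for f :: "'k poly"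
      by (rule word_act_eqI)
        (simp add: word_act_append diag[OF 1(3)] diag[OF 1(4)] word_act_smult mult.commute)
    then have "word_act (p @ (y @ x) @ q) f = word_act (p @ (x @ y) @ q) f" for f :: "'k poly"
      by (simp only: word_act_append[of p] word_act_append[of _ q])
    then show ?thesis unfolding 1(1,2) by (simp add: fun_eq_iff)
  qed
qed

section \<open>Rook numbers\<close>

lemma rook_placement_subset: "rook_placement B P \<Longrightarrow> P \<subseteq> B"
  by (simp add: rook_placement_def)

lemma finite_rook_placements: "finite B \<Longrightarrow> finite {P. rook_placement B P \<and> card P = k}"
  by (rule finite_subset[of _ "Pow B"]) (auto simp: rook_placement_def)

lemma rook_placement_inj_snd: "rook_placement B P \<Longrightarrow> inj_on snd P"
  unfolding rook_placement_def inj_on_def by blast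

lemma rook_number_0: "finite B \<Longrightarrow> rook_number 0 B = 1"
proof -
  assume B: "finite B"
  have "P = {}" if "rook_placement B P" "card P = 0" for P
    using that(2) finite_subset[OF rook_placement_subset[OF that(1)] B] by simp
  moreover have "rook_placement B {}" by (simp add: rook_placement_def)
  ultimately have "{P. rook_placement B P \<and> card P = 0} = {{}}" by (auto simp del: card_0_eq)
  then show ?thesis by (simp add: rook_number_def)
qed

lemma rook_number_Suc_empty: "rook_number (Suc k) {} = 0"
  by (auto simp: rook_number_def rook_placement_def card_eq_0_iff)

text \<open>Either column \<open>j\<close> is empty, or deleting its rook leaves \<open>k\<close>
  rooks on \<open>B\<close>. These occupy \<open>k\<close> distinct rows, all in \<open>R\<close>,
  so \<open>card R - k\<close> rows were available.\<close>

lemma rook_number_full_column: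
  assumes B: "finite B" "snd ` B \<subseteq> R" and R: "finite R" and j: "j \<notin> fst ` B"
  shows "rook_number (Suc k) (B \<union> {j} \<times> R) =
    rook_number (Suc k) B + (card R - k) * rook_number k B"
proof -
  let ?pl = "\<lambda>k. {P. rook_placement B P \<and> card P = k}"
  \<comment> \<open>Pairs of a placement on \<open>B\<close> and a free row for the additional
    rook.\<close>
  let ?S = "SIGMA P:?pl k. R - snd ` P"
  let ?f = "\<lambda>(P, i). insert (j, i) P"
  have jB: "(j, i) \<notin> B" for i using j by force
  have sub: "P \<subseteq> B" "finite P" "\<And>i. (j, i) \<notin> P" if "rook_placement B P" for P
    using rook_placement_subset[OF that] finite_subset[OF _ B(1)] jB by blast+
  have eq: "{P. rook_placement (B \<union> {j} \<times> R) P \<and> card P = Suc k} = ?pl (Suc k) \<union> ?f ` ?S"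
  proof (intro equalityI subsetI)
    fix P assume P: "P \<in> {P. rook_placement (B \<union> {j} \<times> R) P \<and> card P = Suc k}"
    then have pl: "rook_placement (B \<union> {j} \<times> R) P" and card: "card P = Suc k" by auto
    show "P \<in> ?pl (Suc k) \<union> ?f ` ?S"
    proof (cases "\<exists>i. (j, i) \<in> P")
      case False
      then have "P \<in> ?pl (Suc k)" using pl card by (auto simp: rook_placement_def)
      then show ?thesis ..
    next
      case True
      then obtain i where i: "(j, i) \<in> P" by blast
      have other: "c \<in> B" "snd c \<noteq> i" if "c \<in> P - {(j, i)}" for c
        using that pl i unfolding rook_placement_def by fastforce+
      have "rook_placement B (P - {(j, i)})"
        using pl other(1) unfolding rook_placement_def by blast
      moreover have "card (P - {(j, i)}) = k" using card i by simp
      moreover have "i \<in> R" using pl i j by (force simp: rook_placement_def)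
      ultimately have "(P - {(j, i)}, i) \<in> ?S" using other(2) by auto
      moreover have "P = ?f (P - {(j, i)}, i)" using i by auto
      ultimately show ?thesis by blast
    qed
  next
    fix P assume "P \<in> ?pl (Suc k) \<union> ?f ` ?S"
    then show "P \<in> {P. rook_placement (B \<union> {j} \<times> R) P \<and> card P = Suc k}"
    proof
      assume "P \<in> ?pl (Suc k)"
      then show ?thesis by (auto simp: rook_placement_def)
    next
      assume "P \<in> ?f ` ?S"
      then obtain Q i where Q: "rook_placement B Q" "card Q = k" "i \<in> R" "i \<notin> snd ` Q"
        and P: "P = insert (j, i) Q" by auto
      have "fst c \<noteq> j \<and> snd c \<noteq> i" if "c \<in> Q" for c
        using that sub(1)[OF Q(1)] j Q(4) by auto
      then have "rook_placement (B \<union> {j} \<times> R) P"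
        using Q(1,3) unfolding rook_placement_def P by auto
      then show ?thesis using sub[OF Q(1)] Q(2) P by simp
    qed
  qed
  have "?pl (Suc k) \<inter> ?f ` ?S = {}"
    using sub(3) by auto
  moreover have fin: "finite (?pl i)" for i using B(1) by (rule finite_rook_placements)
  moreover have finS: "finite ?S" using fin R by (intro finite_SigmaI) auto
  moreover have "inj_on ?f ?S"
  proof (rule inj_onI)
    fix s t assume s: "s \<in> ?S" and t: "t \<in> ?S" and st: "?f s = ?f t"
    obtain P i Q i' where [simp]: "s = (P, i)" "t = (Q, i')" by (cases s; cases t)
    have "(j, i) \<notin> P" "(j, i) \<notin> Q" "(j, i') \<notin> P" "(j, i') \<notin> Q" using s t sub(3) by auto
    moreover have "insert (j, i) P = insert (j, i') Q" using st by simp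
    ultimately show "s = t" by (auto simp: set_eq_iff)
  qed
  moreover have "card ?S = (card R - k) * card (?pl k)"
  proof -
    have "card (R - snd ` P) = card R - k" if "P \<in> ?pl k" for P
    proof -
      have "snd ` P \<subseteq> R" using that rook_placement_subset B(2) by blast
      then show ?thesis
        using that card_image[OF rook_placement_inj_snd, of B P] sub(2)[of P]
        by (simp add: card_Diff_subset)
    qed
    then show ?thesis using fin R by (simp add: card_SigmaI mult.commute)
  qed
  ultimately show ?thesis
    unfolding rook_number_def eq by (simp add: card_Un_disjoint card_image)
qed

section \<open>Ferrers boards grown by appending letters\<close>

lemma U_positions_snoc:
  "U_positions (w @ [l]) = U_positions w @ (if l = U then [length w] else [])"
  by (auto simp: U_positions_def nth_append intro: filter_cong)

lemma length_U_positions: "length (U_positions w) = count_list w U"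
proof (induction w rule: rev_induct)
  case Nil
  show ?case by (simp add: U_positions_def)
qed (simp add: U_positions_snoc)

lemma U_positions_less:
  assumes "i < count_list w U"
  shows "U_positions w ! i < length w"
proof -
  have "U_positions w ! i \<in> set (U_positions w)"
    using assms by (simp add: length_U_positions)
  then show ?thesis by (simp add: U_positions_def)
qed

lemma Ds_before_snoc:
  "1 \<le> j \<Longrightarrow> j \<le> count_list w U \<Longrightarrow> Ds_before (w @ [l]) j = Ds_before w j"
  using U_positions_less[of "j - 1" w]
  by (auto simp: Ds_before_def U_positions_snoc nth_append length_U_positions)

lemma Ds_before_snoc_U: "Ds_before (w @ [U]) (Suc (count_list w U)) = count_list w D"
  by (simp add: Ds_before_def U_positions_snoc nth_append length_U_positions)

lemma Ds_before_le: "Ds_before w j \<le> count_list w D"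
  by (metis Ds_before_def append_take_drop_id count_list_append le_add1)

lemma finite_ferrers_board: "finite (ferrers_board w)"
  using is_board_ferrers_board by (simp add: is_board_def)

lemma ferrers_board_Nil: "ferrers_board [] = {}"
  by (auto simp: ferrers_board_def)

lemma ferrers_board_snoc_D: "ferrers_board (w @ [D]) = ferrers_board w"
  by (auto simp: ferrers_board_def Ds_before_snoc)

lemma ferrers_board_snoc_U:
  "ferrers_board (w @ [U]) = ferrers_board w \<union> {Suc (count_list w U)} \<times> {1..count_list w D}"
  by (auto simp: ferrers_board_def Ds_before_snoc Ds_before_snoc_U le_Suc_eq)

text \<open>The new column contains every row used so far, since no earlier \<open>U\<close> is
  preceded by more \<open>D\<close>s.\<close>

lemma rook_number_snoc_U:
  "rook_number (Suc k) (ferrers_board (w @ [U])) =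
     rook_number (Suc k) (ferrers_board w) + (count_list w D - k) * rook_number k (ferrers_board w)"
proof -
  have "snd ` ferrers_board w \<subseteq> {1..count_list w D}" "Suc (count_list w U) \<notin> fst ` ferrers_board w"
    using Ds_before_le order_trans by (fastforce simp: ferrers_board_def)+
  then show ?thesis
    unfolding ferrers_board_snoc_U by (subst rook_number_full_column) (auto simp: finite_ferrers_board)
qed

text \<open>Ensures that truncated exponents in the normal ordered form only occur with coefficient
  0.\<close>

lemma rook_number_eq_0:
  "count_list w U < k \<or> count_list w D < k \<Longrightarrow> rook_number k (ferrers_board w) = 0"
proof (induction w arbitrary: k rule: rev_induct)
  case Nil
  then show ?case by (cases k) (auto simp: ferrers_board_Nil rook_number_Suc_empty)
next
  case (snoc l w)
  show ?case
  proof (cases l)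
    case D
    then show ?thesis using snoc ferrers_board_snoc_D
      by (auto simp: less_Suc_eq intro!: snoc.IH)
  next
    case U
    then obtain i where "k = Suc i" using snoc.prems by (cases k) auto
    then show ?thesis using U snoc by (auto simp: rook_number_snoc_U)
  qed
qed

section \<open>Normal ordering in the Weyl algebra\<close>

lemma weyl_act_0 [simp]: "weyl_act 0 p = 0"
  by transfer simp

text \<open>The action separates 0 from 1; the instance makes \<open>of_nat\<close> available in the
  Weyl algebra.\<close>

instance weyl :: (field) ring_1
proof
  show "(0 :: 'a weyl) \<noteq> 1"
    using weyl_act_one[of "1 :: 'a poly"] by (metis weyl_act_0 zero_neq_one)
qed

lemma phi_Nil [simp]: "phi [] = 1"
  by (simp add: phi_def)

lemma phi_Cons [simp]: "phi (l # w) = weyl_letter l * phi w"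
  by (simp add: phi_def)

lemma phi_append [simp]: "phi (v @ w) = phi v * phi w"
  by (simp add: phi_def)

lemma weyl_act_phi: "weyl_act (phi w) = word_act w"
  by (induction w) (auto simp: fun_eq_iff weyl_act_one weyl_act_mult weyl_act_letter)

abbreviation weyl_D :: "'k::field weyl" where "weyl_D \<equiv> weyl_letter D"
abbreviation weyl_U :: "'k::field weyl" where "weyl_U \<equiv> weyl_letter U"

lemma D_power_U: "weyl_D ^ n * weyl_U = weyl_U * weyl_D ^ n + of_nat n * (weyl_D :: 'k::field weyl) ^ (n - 1)"
proof (induction n)
  case (Suc n)
  have DU: "weyl_D * weyl_U = weyl_U * weyl_D + (1 :: 'k weyl)"
    using weyl_relation[where 'k = 'k] by (simp add: algebra_simps)
  have "weyl_D ^ Suc n * weyl_U = weyl_D * (weyl_D ^ n * weyl_U :: 'k weyl)"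
    by (simp add: mult.assoc)
  also have "\<dots> = (weyl_D * weyl_U) * weyl_D ^ n + of_nat n * (weyl_D * weyl_D ^ (n - 1))"
    unfolding Suc.IH by (simp add: distrib_left mult.assoc mult_of_nat_commute)
  \<comment> \<open>For \<open>n = 0\<close> the exponent \<open>n - 1\<close> truncates, but the
    coefficient is 0.\<close>
  also have "of_nat n * (weyl_D * weyl_D ^ (n - 1)) = of_nat n * (weyl_D :: 'k weyl) ^ n"
    by (cases n) auto
  finally show ?case unfolding DU by (simp add: algebra_simps)
qed simp


text \<open>A new \<open>D\<close> raises the power of \<open>weyl_D\<close> and leaves the board
  alone. Moving a new \<open>U\<close> to the left past \<open>weyl_D ^ (b - k)\<close> loses one
  \<open>weyl_D\<close> in \<open>b - k\<close> ways, just as many as the free cells for a rook in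
  the new column.\<close>

lemma phi_normal_order:
  "phi w = (\<Sum>k\<le>count_list w D. of_nat (rook_number k (ferrers_board w)) *
     (weyl_U ^ (count_list w U - k) * (weyl_D :: 'k::field weyl) ^ (count_list w D - k)))"
proof (induction w rule: rev_induct)
  case Nil
  show ?case by (simp add: ferrers_board_Nil rook_number_0)
next
  case (snoc l w)
  define a b where "a = count_list w U" and "b = count_list w D"
  define r where "r k = rook_number k (ferrers_board w)" for k
  have r0: "r k = 0" if "a < k \<or> b < k" for k
    using that rook_number_eq_0 by (auto simp: r_def a_def b_def)
  have IH: "phi w = (\<Sum>k\<le>b. of_nat (r k) * (weyl_U ^ (a - k) * (weyl_D :: 'k weyl) ^ (b - k)))"
    using snoc.IH by (simp add: a_def b_def r_def)
  show ?case
  proof (cases l)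
    case D
    have "phi (w @ [D]) = (\<Sum>k\<le>b. of_nat (r k) * (weyl_U ^ (a - k) * (weyl_D :: 'k weyl) ^ (Suc b - k)))"
      by (simp add: IH sum_distrib_right mult.assoc Suc_diff_le flip: power_Suc2)
    \<comment> \<open>The added term \<open>k = Suc b\<close> has coefficient 0.\<close>
    also have "\<dots> = (\<Sum>k\<le>Suc b. of_nat (r k) * (weyl_U ^ (a - k) * weyl_D ^ (Suc b - k)))"
      by (simp add: r0)
    finally show ?thesis by (simp add: D ferrers_board_snoc_D a_def b_def r_def)
  next
    case U
    define M where "M i j = weyl_U ^ i * (weyl_D :: 'k weyl) ^ j" for i j
    \<comment> \<open>For \<open>k > a\<close> the exponents truncate, but then
      \<open>r k = 0\<close>.\<close>
    have U_right: "of_nat (r k) * M (a - k) (b - k) * weyl_U =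
        of_nat (r k) * M (Suc a - k) (b - k) + of_nat ((b - k) * r k) * M (a - k) (b - Suc k)" for k
    proof (cases "k \<le> a")
      case True
      have "M (a - k) (b - k) * weyl_U =
          weyl_U ^ (a - k) * weyl_U * weyl_D ^ (b - k) + of_nat (b - k) * M (a - k) (b - Suc k)"
        unfolding M_def mult.assoc D_power_U
        by (simp add: distrib_left mult.assoc mult_of_nat_commute)
      also have "weyl_U ^ (a - k) * weyl_U * weyl_D ^ (b - k) = M (Suc a - k) (b - k)"
        unfolding M_def using True by (simp add: Suc_diff_le power_commutes)
      finally show ?thesis by (simp add: mult.assoc distrib_left mult.commute[of "b - k"])
    qed (simp add: r0)
    have r': "rook_number 0 (ferrers_board (w @ [U])) = 1" "r 0 = 1"
      "rook_number (Suc k) (ferrers_board (w @ [U])) = r (Suc k) + (b - k) * r k" for k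
      by (simp_all add: r_def b_def rook_number_snoc_U rook_number_0 finite_ferrers_board)
    have "phi (w @ [U]) = (\<Sum>k\<le>b. of_nat (r k) * M (a - k) (b - k) * weyl_U)"
      by (simp add: IH M_def sum_distrib_right)
    also have "\<dots> = (\<Sum>k\<le>b. of_nat (r k) * M (Suc a - k) (b - k)) +
        (\<Sum>k\<le>b. of_nat ((b - k) * r k) * M (a - k) (b - Suc k))"
      by (simp only: U_right sum.distrib)
    \<comment> \<open>The dropped term \<open>k = b\<close> carries the factor
      \<open>b - k = 0\<close>.\<close>
    also have "(\<Sum>k\<le>b. of_nat ((b - k) * r k) * M (a - k) (b - Suc k)) =
        (\<Sum>k<b. of_nat ((b - k) * r k) * M (a - k) (b - Suc k))"
      by (simp flip: lessThan_Suc_atMost)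
    \<comment> \<open>Splitting off \<open>k = 0\<close> and shifting the index gives both sums the
      monomials \<open>M (a - k) (b - Suc k)\<close>, whose coefficients then add up as in
      \<open>r'\<close>.\<close>
    also have "(\<Sum>k\<le>b. of_nat (r k) * M (Suc a - k) (b - k)) =
        M (Suc a) b + (\<Sum>k<b. of_nat (r (Suc k)) * M (a - k) (b - Suc k))"
      by (subst sum.atMost_shift) (simp add: r')
    also have "M (Suc a) b + (\<Sum>k<b. of_nat (r (Suc k)) * M (a - k) (b - Suc k)) +
        (\<Sum>k<b. of_nat ((b - k) * r k) * M (a - k) (b - Suc k)) =
        (\<Sum>k\<le>b. of_nat (rook_number k (ferrers_board (w @ [U]))) * M (Suc a - k) (b - k))"
      by (subst sum.atMost_shift) (simp add: r' sum.distrib distrib_right add.assoc)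
    finally show ?thesis by (simp add: U M_def a_def b_def)
  qed
qed

lemma rook_equivalent_imp_phi_eq:
  assumes "count_list u D = count_list v D" "count_list u U = count_list v U"
    and "rook_equivalent (ferrers_board u) (ferrers_board v)"
  shows "phi u = (phi v :: 'k::field weyl)"
  unfolding phi_normal_order[of u] phi_normal_order[of v]
  using assms by (simp add: rook_equivalent_def)

section \<open>Recovering the rook numbers from the action\<close>

lemma weyl_act_sum: "weyl_act (\<Sum>i\<in>A. f i) p = (\<Sum>i\<in>A. weyl_act (f i) p)"
  by (induction A rule: infinite_finite_induct) (simp_all add: weyl_act_add)

lemma weyl_act_of_nat: "weyl_act (of_nat n) p = of_nat n * p"
  by (induction n) (simp_all add: weyl_act_add weyl_act_one distrib_right)

lemma weyl_act_D_power: "weyl_act (weyl_D ^ n) p = (pderiv ^^ n) p"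
  by (induction n) (simp_all add: weyl_act_one weyl_act_mult weyl_act_letter)

lemma weyl_act_U_power: "weyl_act (weyl_U ^ n) p = monom 1 n * p"
  by (induction n) (simp_all add: weyl_act_one weyl_act_mult weyl_act_letter monom_Suc)

lemma word_act_normal_order:
  "word_act w p = (\<Sum>k\<le>count_list w D. of_nat (rook_number k (ferrers_board w)) *
     (monom 1 (count_list w U - k) * (pderiv ^^ (count_list w D - k)) (p :: 'k::field poly)))"
  by (simp only: weyl_act_phi[symmetric] phi_normal_order weyl_act_sum weyl_act_of_nat
      weyl_act_mult weyl_act_D_power weyl_act_U_power)

lemma higher_pderiv_monom_same:
  "(pderiv ^^ n) (monom (1 :: 'k::field_char_0) n) = monom (fact n) 0"
  by (rule poly_eqI) (auto simp: coeff_higher_pderiv pochhammer_fact)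

lemma higher_pderiv_monom_greater:
  "n < m \<Longrightarrow> (pderiv ^^ m) (monom (c :: 'k::field_char_0) n) = 0"
  by (rule poly_eqI) (simp add: coeff_higher_pderiv)

text \<open>Evaluated at the monomial of degree \<open>j\<close>, the normal ordered form only involves the rook numbers
  with index at least \<open>#D - j\<close>, so the rook numbers can be read off one after another.\<close>

lemma act_eq_imp_rook_equivalent:
  fixes u v :: word
  assumes D_eq: "count_list u D = count_list v D" and U_eq: "count_list u U = count_list v U"
    and act: "\<And>p :: 'k::field_char_0 poly. word_act u p = word_act v p"
  shows "rook_equivalent (ferrers_board u) (ferrers_board v)"
proof -
  define a b where "a = count_list v U" and "b = count_list v D"
  have u: "count_list u U = a" "count_list u D = b"
    and v: "count_list v U = a" "count_list v D = b"
    using D_eq U_eq by (simp_all add: a_def b_def)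
  let ?r = "\<lambda>w k. rook_number k (ferrers_board w)"
  \<comment> \<open>Counting down from \<open>b\<close> makes \<open>j\<close> the degree of the
    test monomial.\<close>
  have eq: "?r u (b - j) = ?r v (b - j)" if "j \<le> b" for j
    using that
  proof (induction j rule: less_induct)
    case (less j)
    define M where "M k = monom 1 (a - k) * (pderiv ^^ (b - k)) (monom (1 :: 'k) j)" for k
    have act_j: "word_act w (monom 1 j) =
        of_nat (?r w (b - j)) * M (b - j) + (\<Sum>k\<in>{..b} - {b - j}. of_nat (?r w k) * M k)"
      if "count_list w U = a" "count_list w D = b" for w
      unfolding word_act_normal_order that M_def[symmetric]
      by (rule sum.remove) auto
    \<comment> \<open>Indices above \<open>b - j\<close> are settled by induction; below it the
      derivative kills the monomial.\<close>
    have "of_nat (?r u k) * M k = of_nat (?r v k) * M k" if "k \<in> {..b} - {b - j}" for k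
    proof (cases "b - k < j")
      case True
      then show ?thesis using less.IH[of "b - k"] that by simp
    next
      case False
      then have "j < b - k" using that less.prems by auto
      then have "M k = 0" by (simp add: M_def higher_pderiv_monom_greater)
      then show ?thesis by simp
    qed
    then have "(\<Sum>k\<in>{..b} - {b - j}. of_nat (?r u k) * M k) = (\<Sum>k\<in>{..b} - {b - j}. of_nat (?r v k) * M k)"
      by (rule sum.cong[OF refl])
    then have "of_nat (?r u (b - j)) * M (b - j) = of_nat (?r v (b - j)) * M (b - j)"
      using act[of "monom 1 j"] by (simp only: act_j[OF u] act_j[OF v] add_right_cancel)
    \<comment> \<open>This is \<open>fact j\<close> times a monomial, nonzero in characteristic
      0.\<close>
    moreover have "M (b - j) \<noteq> 0"
      using less.prems by (simp add: M_def higher_pderiv_monom_same)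
    ultimately show ?case by simp
  qed
  show ?thesis
    unfolding rook_equivalent_def
  proof
    fix k show "?r u k = ?r v k"
    proof (cases "k \<le> b")
      case True
      then show ?thesis using eq[of "b - k"] by simp
    next
      case False
      then show ?thesis using D_eq by (simp add: rook_number_eq_0 b_def)
    qed
  qed
qed

lemma final_height_eq_counts: "final_height w = int (count_list w U) - int (count_list w D)"
  by (simp add: final_height_def height_def)

lemma length_eq_counts: "length w = count_list w U + count_list w D"
proof (induction w)
  case (Cons l w)
  then show ?case by (cases l) auto
qed simp

theorem theorem8p2:
  fixes u v :: word
  assumes "count_list u D = count_list v D"
    and "count_list u U = count_list v U"
  shows "((phi u :: 'k::field_char_0 weyl) = phi v
            \<longleftrightarrow> rook_equivalent (ferrers_board u) (ferrers_board v))
       \<and> (rook_equivalent (ferrers_board u) (ferrers_board v) \<longleftrightarrow> bal_equiv u v)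
       \<and> (rook_equivalent (ferrers_board u) (ferrers_board v) \<longleftrightarrow> flip_equiv u v)
       \<and> (rook_equivalent (ferrers_board u) (ferrers_board v)
            \<longleftrightarrow> final_height u = final_height v \<and> H u = H v)
       \<and> (rook_equivalent (ferrers_board u) (ferrers_board v)
            \<longleftrightarrow> final_height u = final_height v \<and> H_NE u = H_NE v)
       \<and> (rook_equivalent (ferrers_board u) (ferrers_board v)
            \<longleftrightarrow> final_height u = final_height v \<and> H_SE u = H_SE v)
       \<and> (rook_equivalent (ferrers_board u) (ferrers_board v)
            \<longleftrightarrow> (\<forall>p :: 'k poly. weyl_act (phi u) p = weyl_act (phi v) p))"
proof -
  let ?R = "rook_equivalent (ferrers_board u) (ferrers_board v)"
  let ?act = "\<forall>p :: 'k poly. word_act u p = word_act v p"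
  have fh: "final_height u = final_height v" and len: "length u = length v"
    using assms by (simp_all add: final_height_eq_counts length_eq_counts)
  note H_NE_iff = visits_eq_iff_U_steps_eq[OF fh] and H_SE_iff = U_steps_eq_iff_D_steps_eq[OF fh]
  \<comment> \<open>The implications close up: rook equivalence gives equal \<open>phi\<close>,
    hence equal action, hence rook equivalence. Equal action also gives equal
    \<open>D_steps\<close>, hence equal visits, hence \<open>bal_equiv\<close>, which returns to
    equal action; \<open>flip_equiv\<close> lies between \<open>bal_equiv\<close> and equal
    visits.\<close>
  have R_phi: "?R \<Longrightarrow> (phi u :: 'k weyl) = phi v"
    using assms by (rule rook_equivalent_imp_phi_eq)
  have phi_act: "?act" if "(phi u :: 'k weyl) = phi v"
    using arg_cong[OF that, of weyl_act] by (simp add: weyl_act_phi)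
  have act_R: "?act \<Longrightarrow> ?R"
    using act_eq_imp_rook_equivalent[where 'k = 'k, OF assms] by blast
  have act_D: "?act \<Longrightarrow> D_steps u = D_steps v"
    using act_eq_imp_D_steps_eq[where 'k = 'k, OF fh] by blast
  have visits_bal: "visits u = visits v \<Longrightarrow> bal_equiv u v"
    by (rule visits_eq_imp_bal_equiv[OF len fh])
  have bal_act: "bal_equiv u v \<Longrightarrow> ?act"
    using bal_equiv_imp_act_eq[where 'k = 'k] by simp
  have "weyl_act (phi u) p = weyl_act (phi v) p \<longleftrightarrow> word_act u p = word_act v p" for p :: "'k poly"
    by (simp add: weyl_act_phi)
  then show ?thesis
    unfolding H_eq_iff H_NE_eq_iff H_SE_eq_iff
    using fh H_NE_iff H_SE_iff R_phi phi_act act_R act_D visits_bal bal_act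
      bal_equiv_imp_flip_equiv[of u v] flip_equiv_imp_visits_eq[of u v] by metis
qed

end
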